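(* Let $K$ be a field and let $R$ be an Archimedean group. Then the Artinian algebra $K(x)^R$ and the Noetherian algebra $K(x)_R$ are fields.
   Context: An Archimedean group is a totally ordered abelian group $R$ (written additively) satisfying the Archimedean property. The Artinian algebra $K(x)^R$ is the set of all formal sums $f(x)=\sum_{a\in R}c_ax^a$ with $c_a\in K$ such that for every $a\in R$ there are only finitely many $b\le a$ with $c_b\ne0$. The Noetherian algebra $K(x)_R$ is the set of all formal sums $\sum_{a\in R}c_ax^a$ such that for every $a\in R$ there are only finitely many $b\ge a$ with $c_b\neq0$. The operations are $$\Big(\sum_a c_ax^a\Big)+\Big(\sum_a d_ax^a\Big)=\sum_a(c_a+d_a)x^a,\qquad \Big(\sum_a c_ax^a\Big)\Big(\sum_b d_bx^b\Big)=\sum_{e}\Big(\sum_{a+b=e}c_ad_b\Big)x^e,\qquad z\Big(\sum_a c_ax^a\Big)=\sum_a(zc_a)x^a\ (z\in K).$$ *)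

theory Defs
  imports "HOL-Algebra.Module"
begin

text \<open>The \<open>n\<close>-fold multiple of \<open>a\<close> is written as a constant sum, since
  there is no scalar multiplication by naturals on a plain additive group.\<close>

class archimedean_group = linordered_ab_group_add +
  assumes archimedean: "0 < a \<Longrightarrow> \<exists>n::nat. b < (\<Sum>i<n. a)"

text \<open>A formal sum of terms \<open>c a x^a\<close> is its coefficient function \<open>c\<close>.  In the product,
  the index set of the coefficient at \<open>e\<close> is restricted to the pairs that can contribute:
  \<open>finsum\<close> over an infinite index set would be the junk value \<open>\<zero>\<close>.\<close>

definition formal_sum_algebra ::
  "('k, 'm) ring_scheme \<Rightarrow> ('r::archimedean_group \<Rightarrow> 'k) set \<Rightarrow> ('k, 'r \<Rightarrow> 'k) module"
  where "formal_sum_algebra K C =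
    \<lparr> carrier = C,
      monoid.mult = (\<lambda>c d e. \<Oplus>\<^bsub>K\<^esub>p\<in>{(a, b). a + b = e \<and> c a \<noteq> \<zero>\<^bsub>K\<^esub> \<and> d b \<noteq> \<zero>\<^bsub>K\<^esub>}.
                              c (fst p) \<otimes>\<^bsub>K\<^esub> d (snd p)),
      one = (\<lambda>a. if a = 0 then \<one>\<^bsub>K\<^esub> else \<zero>\<^bsub>K\<^esub>),
      zero = (\<lambda>a. \<zero>\<^bsub>K\<^esub>),
      add = (\<lambda>c d a. c a \<oplus>\<^bsub>K\<^esub> d a),
      smult = (\<lambda>z c a. z \<otimes>\<^bsub>K\<^esub> c a) \<rparr>"

definition artinian_algebra ::
  "('k, 'm) ring_scheme \<Rightarrow> ('k, 'r::archimedean_group \<Rightarrow> 'k) module"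
  where "artinian_algebra K = formal_sum_algebra K
    {c. (\<forall>a. c a \<in> carrier K) \<and> (\<forall>a. finite {b. b \<le> a \<and> c b \<noteq> \<zero>\<^bsub>K\<^esub>})}"

definition noetherian_algebra ::
  "('k, 'm) ring_scheme \<Rightarrow> ('k, 'r::archimedean_group \<Rightarrow> 'k) module"
  where "noetherian_algebra K = formal_sum_algebra K
    {c. (\<forall>a. c a \<in> carrier K) \<and> (\<forall>a. finite {b. b \<ge> a \<and> c b \<noteq> \<zero>\<^bsub>K\<^esub>})}"

end

theory Submission
  imports Defs "HOL-Algebra.QuotRing"
begin

text \<open>
  The substance is that a nonzero Artinian sum \<open>f\<close> is invertible.  Its support has a least
  element \<open>m\<close>, so multiplying \<open>f\<close> by the monomial \<open>(f m)\<inverse> x^(-m)\<close> gives a sum \<open>1 - n\<close> whose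
  perturbation \<open>n\<close>, unless zero, is supported on \<open>[\<epsilon>, \<infinity>)\<close> for some \<open>\<epsilon> > 0\<close>.  An inverse of \<open>1 - n\<close> is a
  solution of \<open>g = 1 + n g\<close>.  Multiplication by \<open>n\<close> is a contraction: if two sums agree below
  \<open>b\<close>, their products with \<open>n\<close> agree below \<open>b + \<epsilon>\<close>.  Hence the \<open>k\<close>-th iterate of
  \<open>g \<mapsto> 1 + n g\<close> is already final below \<open>k \<epsilon>\<close>.  By the Archimedean property the bounds \<open>k \<epsilon>\<close>
  exceed every exponent, so the iterates converge coefficientwise; below any exponent the limit
  coincides with a single iterate, which is why it is again an Artinian sum and solves the equation
  (\<open>left_finite_fixed_point\<close>).

  For the ring axioms, a product coefficient is rewritten as \<open>\<Sum>a\<in>S. c a * d (e - a)\<close> over an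
  arbitrary finite set \<open>S\<close> that is large enough (\<open>cauchy_product_eq_finsum\<close>).  Two such sums can
  then be taken over a common index set, and associativity becomes an exchange of two finite sums.

  Reversing exponents, \<open>x^a \<mapsto> x^(-a)\<close>, identifies the two algebras, so the Noetherian one
  inherits the field structure.
\<close>

section \<open>Products of sums with left-finite support\<close>

text \<open>The product does not depend on the carrier, so the Artinian and the Noetherian algebra
  share this one; \<open>UNIV\<close> is an arbitrary choice.\<close>

definition cauchy_product ::
  "('k, 'm) ring_scheme \<Rightarrow> ('r::archimedean_group \<Rightarrow> 'k) \<Rightarrow> ('r \<Rightarrow> 'k) \<Rightarrow> 'r \<Rightarrow> 'k"
  where "cauchy_product K = monoid.mult (formal_sum_algebra K UNIV)"

definition left_finite :: "('k, 'm) ring_scheme \<Rightarrow> ('r::archimedean_group \<Rightarrow> 'k) set"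
  where "left_finite K = carrier (artinian_algebra K)"

lemma left_finiteI:
  assumes "\<And>a. c a \<in> carrier K" and "\<And>a. finite {b. b \<le> a \<and> c b \<noteq> \<zero>\<^bsub>K\<^esub>}"
  shows "c \<in> left_finite K"
  using assms by (simp add: left_finite_def artinian_algebra_def formal_sum_algebra_def)

lemma left_finite_coeff: "c \<in> left_finite K \<Longrightarrow> c a \<in> carrier K"
  by (simp add: left_finite_def artinian_algebra_def formal_sum_algebra_def)

lemma left_finite_finite: "c \<in> left_finite K \<Longrightarrow> finite {b. b \<le> a \<and> c b \<noteq> \<zero>\<^bsub>K\<^esub>}"
  by (simp add: left_finite_def artinian_algebra_def formal_sum_algebra_def)

lemma artinian_algebra_simps:
  "carrier (artinian_algebra K) = left_finite K"
  "monoid.mult (artinian_algebra K) = cauchy_product K"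
  "one (artinian_algebra K) = (\<lambda>a. if a = 0 then \<one>\<^bsub>K\<^esub> else \<zero>\<^bsub>K\<^esub>)"
  "zero (artinian_algebra K) = (\<lambda>a. \<zero>\<^bsub>K\<^esub>)"
  "add (artinian_algebra K) = (\<lambda>c d a. c a \<oplus>\<^bsub>K\<^esub> d a)"
  by (simp_all add: left_finite_def cauchy_product_def artinian_algebra_def formal_sum_algebra_def)

lemma left_finite_least_exponent:
  assumes c: "c \<in> left_finite K" and a: "c a \<noteq> \<zero>\<^bsub>K\<^esub>"
  obtains m where "c m \<noteq> \<zero>\<^bsub>K\<^esub>" and "\<And>b. b < m \<Longrightarrow> c b = \<zero>\<^bsub>K\<^esub>"
proof -
  let ?B = "{b. b \<le> a \<and> c b \<noteq> \<zero>\<^bsub>K\<^esub>}"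
  have fin: "finite ?B" and ne: "?B \<noteq> {}"
    using left_finite_finite[OF c] a by auto
  have "Min ?B \<in> ?B"
    using Min_in[OF fin ne] .
  moreover have "c b = \<zero>\<^bsub>K\<^esub>" if "b < Min ?B" for b
  proof (rule ccontr)
    assume "c b \<noteq> \<zero>\<^bsub>K\<^esub>"
    moreover have "b \<le> a" using that \<open>Min ?B \<in> ?B\<close> by auto
    ultimately have "Min ?B \<le> b" by (intro Min_le fin) simp
    with that show False by simp
  qed
  ultimately show thesis using that[of "Min ?B"] by blast
qed

lemma left_finite_lower_bound:
  assumes "c \<in> left_finite K"
  obtains m where "\<And>b. b < m \<Longrightarrow> c b = \<zero>\<^bsub>K\<^esub>"
  using left_finite_least_exponent[OF assms] by metis

lemma (in semiring) finsum_swap: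
  assumes "finite A" "finite B" "\<And>a b. \<lbrakk> a \<in> A; b \<in> B \<rbrakk> \<Longrightarrow> f a b \<in> carrier R"
  shows "(\<Oplus>a\<in>A. \<Oplus>b\<in>B. f a b) = (\<Oplus>b\<in>B. \<Oplus>a\<in>A. f a b)"
  using assms(1,3)
proof (induction A rule: finite_induct)
  case empty
  then show ?case by simp
next
  case (insert x F)
  have "(\<Oplus>a\<in>insert x F. \<Oplus>b\<in>B. f a b) = (\<Oplus>b\<in>B. f x b) \<oplus> (\<Oplus>b\<in>B. \<Oplus>a\<in>F. f a b)"
    using insert by (subst finsum_insert) (auto intro!: finsum_closed)
  also have "\<dots> = (\<Oplus>b\<in>B. f x b \<oplus> (\<Oplus>a\<in>F. f a b))"
    using insert by (intro finsum_addf[symmetric]) (auto intro!: finsum_closed)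
  also have "\<dots> = (\<Oplus>b\<in>B. \<Oplus>a\<in>insert x F. f a b)"
  proof (intro finsum_cong')
    fix b assume "b \<in> B"
    then show "f x b \<oplus> (\<Oplus>a\<in>F. f a b) = (\<Oplus>a\<in>insert x F. f a b)"
      using insert by (subst finsum_insert) auto
  qed (use insert in \<open>auto intro!: finsum_closed\<close>)
  finally show ?case .
qed

context cring
begin

text \<open>The freedom in the choice of \<open>S\<close> is what makes the ring axioms manageable: the sets of
  contributing exponents of different products never have to be compared.\<close>

lemma cauchy_product_eq_finsum:
  fixes c d :: "'r::archimedean_group \<Rightarrow> 'a"
  assumes c: "\<And>a. c a \<in> carrier R" and d: "\<And>a. d a \<in> carrier R"
    and S: "finite S" "\<And>a. \<lbrakk> c a \<noteq> \<zero>; d (e - a) \<noteq> \<zero> \<rbrakk> \<Longrightarrow> a \<in> S"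
  shows "cauchy_product R c d e = (\<Oplus>a\<in>S. c a \<otimes> d (e - a))"
proof -
  let ?T = "{a. c a \<noteq> \<zero> \<and> d (e - a) \<noteq> \<zero>}"
  have pairs: "{(a, b). a + b = e \<and> c a \<noteq> \<zero> \<and> d b \<noteq> \<zero>} = (\<lambda>a. (a, e - a)) ` ?T"
    by (auto simp: image_iff)
  have "cauchy_product R c d e = (\<Oplus>p\<in>(\<lambda>a. (a, e - a)) ` ?T. c (fst p) \<otimes> d (snd p))"
    by (simp add: cauchy_product_def formal_sum_algebra_def pairs)
  also have "\<dots> = (\<Oplus>a\<in>?T. c a \<otimes> d (e - a))"
    by (subst finsum_reindex) (auto simp: inj_on_def c d)
  also have "\<dots> = (\<Oplus>a\<in>S. c a \<otimes> d (e - a))"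
    using S by (intro add.finprod_mono_neutral_cong_left) (auto simp: c d)
  finally show ?thesis .
qed

lemma cauchy_product_nonzeroE:
  fixes c d :: "'r::archimedean_group \<Rightarrow> 'a"
  assumes "\<And>a. c a \<in> carrier R" "\<And>a. d a \<in> carrier R" "cauchy_product R c d e \<noteq> \<zero>"
  obtains a where "c a \<noteq> \<zero>" "d (e - a) \<noteq> \<zero>"
  using cauchy_product_eq_finsum[of c d "{}" e] assms by fastforce

lemma cauchy_product_below:
  fixes c d :: "'r::archimedean_group \<Rightarrow> 'a"
  assumes "\<And>a. c a \<in> carrier R" "\<And>a. d a \<in> carrier R"
    and m: "\<And>a. a < m \<Longrightarrow> c a = \<zero>" and n: "\<And>a. a < n \<Longrightarrow> d a = \<zero>" and e: "e < m + n"
  shows "cauchy_product R c d e = \<zero>"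
proof (rule ccontr)
  assume "cauchy_product R c d e \<noteq> \<zero>"
  then obtain a where "c a \<noteq> \<zero>" "d (e - a) \<noteq> \<zero>"
    using cauchy_product_nonzeroE assms(1,2) by blast
  then have "m \<le> a" "n \<le> e - a" using m n by (meson not_le)+
  then have "m + n \<le> a + (e - a)" by (rule add_mono)
  with e show False by simp
qed

lemma left_finite_product_eq:
  fixes c d :: "'r::archimedean_group \<Rightarrow> 'a"
  assumes c: "c \<in> left_finite R" and d: "d \<in> left_finite R"
    and m: "\<And>b. b < m \<Longrightarrow> d b = \<zero>" and u: "e - m \<le> u"
  shows "cauchy_product R c d e = (\<Oplus>a\<in>{a. a \<le> u \<and> c a \<noteq> \<zero>}. c a \<otimes> d (e - a))"
proof (rule cauchy_product_eq_finsum)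
  fix a assume "c a \<noteq> \<zero>" "d (e - a) \<noteq> \<zero>"
  then have "m \<le> e - a" using m by (meson not_le)
  then have "a \<le> e - m" by (simp add: algebra_simps)
  then show "a \<in> {a. a \<le> u \<and> c a \<noteq> \<zero>}" using u \<open>c a \<noteq> \<zero>\<close> by simp
qed (use c d in \<open>auto intro: left_finite_coeff left_finite_finite\<close>)

lemma left_finite_product:
  fixes c d :: "'r::archimedean_group \<Rightarrow> 'a"
  assumes c: "c \<in> left_finite R" and d: "d \<in> left_finite R"
  shows "cauchy_product R c d \<in> left_finite R"
proof (rule left_finiteI)
  obtain m where m: "\<And>b. b < m \<Longrightarrow> c b = \<zero>" using left_finite_lower_bound[OF c] by blast
  obtain n where n: "\<And>b. b < n \<Longrightarrow> d b = \<zero>" using left_finite_lower_bound[OF d] by blast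
  note coeff = left_finite_coeff[OF c] left_finite_coeff[OF d]
  show "cauchy_product R c d e \<in> carrier R" for e
    by (subst left_finite_product_eq[where m = n, OF c d _ order_refl])
      (auto intro!: finsum_closed coeff n)
  fix e
  let ?A = "{a. a \<le> e - n \<and> c a \<noteq> \<zero>}" and ?B = "{b. b \<le> e - m \<and> d b \<noteq> \<zero>}"
  have "{x. x \<le> e \<and> cauchy_product R c d x \<noteq> \<zero>} \<subseteq> (\<lambda>(a, b). a + b) ` (?A \<times> ?B)"
  proof
    fix x assume "x \<in> {x. x \<le> e \<and> cauchy_product R c d x \<noteq> \<zero>}"
    then have x: "x \<le> e" "cauchy_product R c d x \<noteq> \<zero>" by auto
    obtain a where a: "c a \<noteq> \<zero>" "d (x - a) \<noteq> \<zero>"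
      using cauchy_product_nonzeroE[OF coeff x(2)] by blast
    have "m \<le> a" "n \<le> x - a" using a m n by (meson not_le)+
    have "a + n \<le> e" using add_left_mono[OF \<open>n \<le> x - a\<close>, of a] x(1) by simp
    moreover have "x - a \<le> e - m" using diff_mono[OF x(1) \<open>m \<le> a\<close>] .
    ultimately have "(a, x - a) \<in> ?A \<times> ?B" using a by (simp add: le_diff_eq)
    then show "x \<in> (\<lambda>(a, b). a + b) ` (?A \<times> ?B)" by (rule rev_image_eqI) simp
  qed
  then show "finite {x. x \<le> e \<and> cauchy_product R c d x \<noteq> \<zero>}"
    by (rule finite_subset) (use c d in \<open>auto intro: left_finite_finite\<close>)
qed

text \<open>Exchanging the components of the contributing pairs carries one coefficient sum over to
  the other; if there are infinitely many such pairs, both sums have the default value \<open>\<zero>\<close>.\<close>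

lemma cauchy_product_commute:
  fixes c d :: "'r::archimedean_group \<Rightarrow> 'a"
  assumes c: "\<And>a. c a \<in> carrier R" and d: "\<And>a. d a \<in> carrier R"
  shows "cauchy_product R c d = cauchy_product R d c"
proof
  fix e
  let ?P = "\<lambda>c d :: 'r \<Rightarrow> 'a. {(a, b). a + b = e \<and> c a \<noteq> \<zero> \<and> d b \<noteq> \<zero>}"
  have swap: "?P d c = prod.swap ` ?P c d"
    by (simp add: set_eq_iff) (metis add.commute)
  have "cauchy_product R d c e = (\<Oplus>p\<in>prod.swap ` ?P c d. d (fst p) \<otimes> c (snd p))"
    by (simp add: cauchy_product_def formal_sum_algebra_def swap)
  also have "\<dots> = (\<Oplus>p\<in>?P c d. c (fst p) \<otimes> d (snd p))"
    by (subst finsum_reindex) (auto simp: c d m_comm[OF d c])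
  also have "\<dots> = cauchy_product R c d e"
    by (simp add: cauchy_product_def formal_sum_algebra_def)
  finally show "cauchy_product R c d e = cauchy_product R d c e" ..
qed

lemma cauchy_product_assoc:
  fixes f g h :: "'r::archimedean_group \<Rightarrow> 'a"
  assumes f: "f \<in> left_finite R" and g: "g \<in> left_finite R" and h: "h \<in> left_finite R"
  shows "cauchy_product R (cauchy_product R f g) h = cauchy_product R f (cauchy_product R g h)"
proof
  fix e
  obtain k where k: "\<And>b. b < k \<Longrightarrow> f b = \<zero>" using left_finite_lower_bound[OF f] by blast
  obtain m where m: "\<And>b. b < m \<Longrightarrow> g b = \<zero>" using left_finite_lower_bound[OF g] by blast
  obtain n where n: "\<And>b. b < n \<Longrightarrow> h b = \<zero>" using left_finite_lower_bound[OF h] by blast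
  note fg = left_finite_product[OF f g] and gh = left_finite_product[OF g h]
  note coeff [simp] = left_finite_coeff[OF f] left_finite_coeff[OF g] left_finite_coeff[OF h]
    left_finite_coeff[OF fg] left_finite_coeff[OF gh]
  have km: "cauchy_product R f g b = \<zero>" if "b < k + m" for b
    by (rule cauchy_product_below[of f g k m]) (use k m that in auto)
  have mn: "cauchy_product R g h b = \<zero>" if "b < m + n" for b
    by (rule cauchy_product_below[of g h m n]) (use m n that in auto)
  \<comment> \<open>The exponents of \<open>f\<close> and of \<open>h\<close> that can occur when three exponents add up to \<open>e\<close>; the
    bounds use only \<open>k\<close>, \<open>m\<close>, \<open>n\<close>, so that the double sums below run over a full rectangle.\<close>
  let ?A = "{a. a \<le> e - (m + n) \<and> f a \<noteq> \<zero>}" and ?C = "{c. c \<le> e - (k + m) \<and> h c \<noteq> \<zero>}"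
  have fin: "finite ?A" "finite ?C"
    using f h by (auto intro: left_finite_finite)
  have inner_fg: "cauchy_product R f g (e - c) = (\<Oplus>a\<in>?A. f a \<otimes> g (e - c - a))"
    if "c \<in> ?C" for c
  proof (cases "n \<le> c")
    case True
    then have "e - c - m \<le> e - (m + n)"
      using diff_left_mono[OF add_left_mono[OF True, of m], of e] by (simp add: algebra_simps)
    with m show ?thesis by (intro left_finite_product_eq[where m = m] f g)
  next
    case False
    then show ?thesis using n that by auto
  qed
  have inner_gh: "cauchy_product R g h (e - a) = (\<Oplus>c\<in>?C. h c \<otimes> g (e - a - c))"
    if "a \<in> ?A" for a
  proof (cases "k \<le> a")
    case True
    then have "e - a - m \<le> e - (k + m)"
      using diff_left_mono[OF add_right_mono[OF True, of m], of e] by (simp add: algebra_simps)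
    then have "cauchy_product R h g (e - a) = (\<Oplus>c\<in>?C. h c \<otimes> g (e - a - c))"
      using m by (intro left_finite_product_eq[where m = m] h g)
    then show ?thesis by (simp add: cauchy_product_commute[of g h])
  next
    case False
    then show ?thesis using k that by auto
  qed
  have "cauchy_product R (cauchy_product R f g) h e
      = cauchy_product R h (cauchy_product R f g) e"
    by (simp add: cauchy_product_commute[of _ h])
  also have "\<dots> = (\<Oplus>c\<in>?C. h c \<otimes> cauchy_product R f g (e - c))"
    using km by (intro left_finite_product_eq[where m = "k + m"] h fg order_refl)
  also have "\<dots> = (\<Oplus>c\<in>?C. \<Oplus>a\<in>?A. f a \<otimes> (h c \<otimes> g (e - a - c)))"
  proof (intro finsum_cong')
    fix c assume "c \<in> ?C"
    have "h c \<otimes> cauchy_product R f g (e - c) = (\<Oplus>a\<in>?A. h c \<otimes> (f a \<otimes> g (e - c - a)))"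
      unfolding inner_fg[OF \<open>c \<in> ?C\<close>] by (rule finsum_rdistr) (use fin in auto)
    also have "\<dots> = (\<Oplus>a\<in>?A. f a \<otimes> (h c \<otimes> g (e - a - c)))"
      by (rule finsum_cong') (auto simp: m_lcomm diff_diff_eq add.commute)
    finally show "h c \<otimes> cauchy_product R f g (e - c)
      = (\<Oplus>a\<in>?A. f a \<otimes> (h c \<otimes> g (e - a - c)))" .
  qed (auto intro!: finsum_closed)
  also have "\<dots> = (\<Oplus>a\<in>?A. \<Oplus>c\<in>?C. f a \<otimes> (h c \<otimes> g (e - a - c)))"
    by (rule finsum_swap) (use fin in auto)
  also have "\<dots> = (\<Oplus>a\<in>?A. f a \<otimes> cauchy_product R g h (e - a))"
  proof (intro finsum_cong')
    fix a assume "a \<in> ?A"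
    show "(\<Oplus>c\<in>?C. f a \<otimes> (h c \<otimes> g (e - a - c))) = f a \<otimes> cauchy_product R g h (e - a)"
      unfolding inner_gh[OF \<open>a \<in> ?A\<close>]
      by (rule finsum_rdistr[symmetric]) (use fin in auto)
  qed auto
  also have "\<dots> = cauchy_product R f (cauchy_product R g h) e"
    using mn by (intro left_finite_product_eq[where m = "m + n", symmetric] f gh order_refl)
  finally show "cauchy_product R (cauchy_product R f g) h e
    = cauchy_product R f (cauchy_product R g h) e" .
qed

section \<open>The ring of Artinian sums\<close>

lemma left_finite_add:
  assumes c: "c \<in> left_finite R" and d: "d \<in> left_finite R"
  shows "(\<lambda>a. c a \<oplus> d a) \<in> left_finite R"
proof (rule left_finiteI)
  show "finite {b. b \<le> a \<and> c b \<oplus> d b \<noteq> \<zero>}" for a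
    by (rule finite_subset[of _ "{b. b \<le> a \<and> c b \<noteq> \<zero>} \<union> {b. b \<le> a \<and> d b \<noteq> \<zero>}"])
      (use c d in \<open>auto intro: left_finite_finite\<close>)
qed (use c d in \<open>auto intro: left_finite_coeff\<close>)

lemma left_finite_minus:
  assumes c: "c \<in> left_finite R"
  shows "(\<lambda>a. \<ominus> c a) \<in> left_finite R"
proof (rule left_finiteI)
  show "finite {b. b \<le> a \<and> \<ominus> c b \<noteq> \<zero>}" for a
    by (rule finite_subset[OF _ left_finite_finite[OF c, of a]]) auto
qed (use c in \<open>auto intro: left_finite_coeff\<close>)

lemma left_finite_monomial:
  assumes "z \<in> carrier R"
  shows "(\<lambda>a. if a = m then z else \<zero>) \<in> left_finite R"
proof (rule left_finiteI)
  show "finite {b. b \<le> a \<and> (if b = m then z else \<zero>) \<noteq> \<zero>}" for a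
    by (rule finite_subset[of _ "{m}"]) auto
qed (use assms in auto)

lemma left_finite_zero: "(\<lambda>a. \<zero>) \<in> left_finite R"
  by (rule left_finiteI) auto

lemma cauchy_product_one:
  fixes c :: "'r::archimedean_group \<Rightarrow> 'a"
  assumes "\<And>a. c a \<in> carrier R"
  shows "cauchy_product R (\<lambda>a. if a = 0 then \<one> else \<zero>) c = c"
proof
  fix e
  show "cauchy_product R (\<lambda>a. if a = 0 then \<one> else \<zero>) c e = c e"
    by (subst cauchy_product_eq_finsum[of _ c "{0}"]) (auto simp: assms split: if_splits)
qed

lemma cauchy_product_distrib:
  fixes c d f :: "'r::archimedean_group \<Rightarrow> 'a"
  assumes c: "c \<in> left_finite R" and d: "d \<in> left_finite R" and f: "f \<in> left_finite R"
  shows "cauchy_product R (\<lambda>a. c a \<oplus> d a) f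
    = (\<lambda>e. cauchy_product R c f e \<oplus> cauchy_product R d f e)"
proof
  fix e
  obtain m where m: "\<And>b. b < m \<Longrightarrow> f b = \<zero>" using left_finite_lower_bound[OF f] by blast
  note coeff [simp] = left_finite_coeff[OF c] left_finite_coeff[OF d] left_finite_coeff[OF f]
  let ?S = "{a. a \<le> e - m \<and> c a \<noteq> \<zero>} \<union> {a. a \<le> e - m \<and> d a \<noteq> \<zero>}"
  have fin: "finite ?S" using c d by (auto intro: left_finite_finite)
  have le: "a \<le> e - m" if "f (e - a) \<noteq> \<zero>" for a
  proof -
    have "m \<le> e - a" using that m by (meson not_le)
    then show ?thesis by (simp add: algebra_simps)
  qed
  have "cauchy_product R (\<lambda>a. c a \<oplus> d a) f e = (\<Oplus>a\<in>?S. (c a \<oplus> d a) \<otimes> f (e - a))"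
    by (rule cauchy_product_eq_finsum) (use fin le in auto)
  also have "\<dots> = (\<Oplus>a\<in>?S. c a \<otimes> f (e - a) \<oplus> d a \<otimes> f (e - a))"
    by (rule finsum_cong') (auto simp: l_distr)
  also have "\<dots> = (\<Oplus>a\<in>?S. c a \<otimes> f (e - a)) \<oplus> (\<Oplus>a\<in>?S. d a \<otimes> f (e - a))"
    by (rule finsum_addf) auto
  also have "(\<Oplus>a\<in>?S. c a \<otimes> f (e - a)) = cauchy_product R c f e"
    by (rule cauchy_product_eq_finsum[symmetric]) (use fin le in auto)
  also have "(\<Oplus>a\<in>?S. d a \<otimes> f (e - a)) = cauchy_product R d f e"
    by (rule cauchy_product_eq_finsum[symmetric]) (use fin le in auto)
  finally show "cauchy_product R (\<lambda>a. c a \<oplus> d a) f e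
    = cauchy_product R c f e \<oplus> cauchy_product R d f e" .
qed

lemma artinian_algebra_cring:
  "cring (artinian_algebra R :: ('a, 'r::archimedean_group \<Rightarrow> 'a) module)"
proof (rule cringI)
  show "abelian_group (artinian_algebra R :: ('a, 'r \<Rightarrow> 'a) module)"
  proof (rule abelian_groupI, unfold artinian_algebra_simps)
    fix c :: "'r \<Rightarrow> 'a" assume c: "c \<in> left_finite R"
    show "\<exists>d\<in>left_finite R. (\<lambda>a. d a \<oplus> c a) = (\<lambda>a. \<zero>)"
      using left_finite_minus[OF c] left_finite_coeff[OF c]
      by (intro bexI[of _ "\<lambda>a. \<ominus> c a"]) (auto simp: l_neg)
  qed (auto intro: left_finite_add left_finite_zero simp: left_finite_coeff a_ac)
  show "comm_monoid (artinian_algebra R :: ('a, 'r \<Rightarrow> 'a) module)"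
  proof (rule comm_monoidI, unfold artinian_algebra_simps)
    fix c d :: "'r \<Rightarrow> 'a" assume "c \<in> left_finite R" "d \<in> left_finite R"
    then show "cauchy_product R c d = cauchy_product R d c"
      by (intro cauchy_product_commute left_finite_coeff)
  qed (simp_all add: left_finite_product left_finite_monomial cauchy_product_assoc
      cauchy_product_one left_finite_coeff)
qed (auto simp: artinian_algebra_simps cauchy_product_distrib)

section \<open>The geometric series as a fixed point\<close>

text \<open>Multiplication by \<open>n\<close> is a contraction, in that it raises by \<open>\<epsilon>\<close> the exponent below which
  two sums agree: every exponent of \<open>n\<close> is at least \<open>\<epsilon>\<close>, so the coefficient of \<open>n g\<close> at \<open>e\<close> only
  involves coefficients of \<open>g\<close> at exponents up to \<open>e - \<epsilon>\<close>.\<close>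

lemma cauchy_product_cong_below:
  fixes n g g' :: "'r::archimedean_group \<Rightarrow> 'a"
  assumes n: "n \<in> left_finite R" and g: "g \<in> left_finite R" and g': "g' \<in> left_finite R"
    and \<epsilon>: "\<And>a. a < \<epsilon> \<Longrightarrow> n a = \<zero>"
    and agree: "\<And>a. a < b \<Longrightarrow> g a = g' a" and e: "e < b + \<epsilon>"
  shows "cauchy_product R n g e = cauchy_product R n g' e"
proof -
  obtain l where l: "\<And>b. b < l \<Longrightarrow> g b = \<zero>" using left_finite_lower_bound[OF g] by blast
  obtain l' where l': "\<And>b. b < l' \<Longrightarrow> g' b = \<zero>" using left_finite_lower_bound[OF g'] by blast
  let ?S = "{a. a \<le> e - min l l' \<and> n a \<noteq> \<zero>}"
  have "cauchy_product R n g e = (\<Oplus>a\<in>?S. n a \<otimes> g (e - a))"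
    by (rule left_finite_product_eq[where m = "min l l'", OF n g]) (auto intro: l)
  also have "\<dots> = (\<Oplus>a\<in>?S. n a \<otimes> g' (e - a))"
  proof (rule finsum_cong')
    fix a assume "a \<in> ?S"
    then have "\<epsilon> \<le> a" using \<epsilon>[of a] by (cases "a < \<epsilon>") (auto simp: not_less)
    have "e < b + a" using e add_left_mono[OF \<open>\<epsilon> \<le> a\<close>, of b] by (rule less_le_trans)
    then show "n a \<otimes> g (e - a) = n a \<otimes> g' (e - a)" by (simp add: agree diff_less_eq)
  qed (simp_all add: left_finite_coeff[OF n] left_finite_coeff[OF g'])
  also have "\<dots> = cauchy_product R n g' e"
    by (rule left_finite_product_eq[where m = "min l l'", OF n g', symmetric]) (auto intro: l')
  finally show ?thesis .
qed

text \<open>The solution is the geometric series \<open>1 + n + n\<^sup>2 + \<dots>\<close>.  Obtaining it from the iterates of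
  \<open>g \<mapsto> 1 + n g\<close> avoids both powers of \<open>n\<close> and infinite sums of formal sums.\<close>

lemma left_finite_fixed_point:
  fixes n :: "'r::archimedean_group \<Rightarrow> 'a"
  assumes n: "n \<in> left_finite R" and pos: "0 < \<epsilon>" and \<epsilon>: "\<And>a. a < \<epsilon> \<Longrightarrow> n a = \<zero>"
  obtains g where "g \<in> left_finite R"
    and "g = (\<lambda>a. (if a = 0 then \<one> else \<zero>) \<oplus> cauchy_product R n g a)"
proof -
  define \<Phi> where "\<Phi> g = (\<lambda>a. (if a = 0 then \<one> else \<zero>) \<oplus> cauchy_product R n g a)" for g
  define G where "G k = (\<Phi> ^^ k) (\<lambda>a. \<zero>)" for k
  define t :: "nat \<Rightarrow> 'r" where "t k = (\<Sum>i<k. \<epsilon>)" for k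
  have G_Suc: "G (Suc k) = \<Phi> (G k)" for k by (simp add: G_def)
  have G: "G k \<in> left_finite R" for k
  proof (induction k)
    case 0
    then show ?case by (simp add: G_def left_finite_zero)
  next
    case (Suc k)
    then show ?case unfolding G_Suc \<Phi>_def
      by (intro left_finite_add left_finite_monomial left_finite_product n) auto
  qed
  have t_Suc: "t (Suc k) = t k + \<epsilon>" for k by (simp add: t_def)
  have t_mono: "t j \<le> t k" if "j \<le> k" for j k
    using that by (rule lift_Suc_mono_le[rotated]) (use pos in \<open>simp add: t_Suc\<close>)
  have step: "G (Suc k) e = G k e" if "e < t k" for k e
    using that
  proof (induction k arbitrary: e)
    case 0
    \<comment> \<open>Below exponent 0 the start value \<open>0\<close> already agrees with its image \<open>1\<close>.\<close>
    then have "e < 0" "e \<noteq> 0" by (auto simp: t_def)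
    moreover have "cauchy_product R n (\<lambda>a. \<zero>) e = \<zero>"
      by (subst cauchy_product_eq_finsum[of _ _ "{}"]) (use n in \<open>auto intro: left_finite_coeff\<close>)
    ultimately show ?case by (simp add: G_def \<Phi>_def)
  next
    case (Suc k)
    have "cauchy_product R n (G (Suc k)) e = cauchy_product R n (G k) e"
      by (rule cauchy_product_cong_below[where \<epsilon> = \<epsilon> and b = "t k", OF n G G])
        (use \<epsilon> Suc in \<open>simp_all add: t_Suc\<close>)
    then show ?case by (simp add: G_Suc[of "Suc k"] G_Suc[of k] \<Phi>_def)
  qed
  have stable: "G k e = G j e" if "j \<le> k" "e < t j" for j k e
    using that(1)
  proof (induction k rule: dec_induct)
    case (step k)
    then show ?case using \<open>\<And>k e. e < t k \<Longrightarrow> G (Suc k) e = G k e\<close> t_mono[OF step(1)] that(2)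
      by (metis less_le_trans)
  qed simp
  have unbounded: "\<exists>k. e < t k" for e
    using archimedean[OF pos, of e] by (simp add: t_def)
  \<comment> \<open>The coefficientwise limit; any \<open>k\<close> with \<open>e < t k\<close> gives the same value.\<close>
  define g where "g e = G (LEAST k. e < t k) e" for e
  have g_eq: "g e = G k e" if "e < t k" for e k
    unfolding g_def
    using Least_le[of "\<lambda>k. e < t k", OF that] LeastI[of "\<lambda>k. e < t k", OF that]
    by (rule stable[symmetric])
  have g: "g \<in> left_finite R"
  proof (rule left_finiteI)
    show "g a \<in> carrier R" for a
      unfolding g_def by (rule left_finite_coeff[OF G])
    fix a
    obtain k where k: "a < t k" using unbounded by blast
    have "{b. b \<le> a \<and> g b \<noteq> \<zero>} = {b. b \<le> a \<and> G k b \<noteq> \<zero>}"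
      using g_eq[of _ k] k by (auto simp: le_less_trans)
    then show "finite {b. b \<le> a \<and> g b \<noteq> \<zero>}"
      using left_finite_finite[OF G] by simp
  qed
  moreover have "g = \<Phi> g"
  proof
    fix e
    obtain k where k: "e < t k" using unbounded by blast
    then have k': "e < t k + \<epsilon>" by (rule less_trans) (use pos in simp)
    have "g e = \<Phi> (G k) e"
      using g_eq[of e "Suc k"] k' by (simp add: t_Suc G_Suc)
    also have "\<dots> = \<Phi> g e"
      unfolding \<Phi>_def
      by (subst cauchy_product_cong_below[where \<epsilon> = \<epsilon> and b = "t k" and g' = g, OF n G g])
        (use \<epsilon> g_eq k' in simp_all)
    finally show "g e = \<Phi> g e" .
  qed
  ultimately show thesis unfolding \<Phi>_def by (rule that)
qed

end

section \<open>Inverses\<close>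

context field
begin

text \<open>The multiplier \<open>u\<close> is the inverse of the leading term of \<open>f\<close>, the monomial
  \<open>(f m)\<inverse> x^(-m)\<close>.\<close>

lemma left_finite_normalise:
  fixes f :: "'r::archimedean_group \<Rightarrow> 'a"
  assumes f: "f \<in> left_finite R" and "f a \<noteq> \<zero>"
  obtains u where "u \<in> left_finite R" "cauchy_product R f u 0 = \<one>"
    and "\<And>b. b < 0 \<Longrightarrow> cauchy_product R f u b = \<zero>"
proof -
  obtain m where m: "f m \<noteq> \<zero>" "\<And>b. b < m \<Longrightarrow> f b = \<zero>"
    using left_finite_least_exponent[OF assms] by blast
  note coeff [simp] = left_finite_coeff[OF f]
  have unit: "f m \<in> Units R" using m by (simp add: field_Units)
  define u where "u = (\<lambda>a. if a = - m then inv (f m) else \<zero>)"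
  have u: "u \<in> left_finite R"
    unfolding u_def using unit by (intro left_finite_monomial) simp
  moreover have "cauchy_product R f u 0 = \<one>"
  proof -
    have "cauchy_product R f u 0 = (\<Oplus>a\<in>{m}. f a \<otimes> u (0 - a))"
      by (rule cauchy_product_eq_finsum) (auto simp: u_def unit split: if_splits)
    also have "\<dots> = f m \<otimes> u (- m)"
      using left_finite_coeff[OF u] by simp
    also have "\<dots> = \<one>" using unit by (simp add: u_def)
    finally show ?thesis .
  qed
  moreover have "cauchy_product R f u b = \<zero>" if "b < 0" for b
    by (rule cauchy_product_below[of f u m "- m"])
      (use that m left_finite_coeff[OF u] in \<open>auto simp: u_def\<close>)
  ultimately show thesis by (rule that)
qed

lemma artinian_algebra_field:
  "field (artinian_algebra R :: ('a, 'r::archimedean_group \<Rightarrow> 'a) module)" (is "field ?A")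
proof -
  interpret A: cring ?A by (rule artinian_algebra_cring)
  show ?thesis
  proof (rule A.cring_fieldI2)
    show "\<zero>\<^bsub>?A\<^esub> \<noteq> \<one>\<^bsub>?A\<^esub>"
      by (auto simp: artinian_algebra_simps dest!: fun_cong[of _ _ 0])
  next
    fix f assume "f \<in> carrier ?A" and "f \<noteq> \<zero>\<^bsub>?A\<^esub>"
    then obtain a where f: "f \<in> left_finite R" "f a \<noteq> \<zero>"
      by (auto simp: artinian_algebra_simps)
    obtain u where u: "u \<in> left_finite R" "cauchy_product R f u 0 = \<one>"
      and below: "\<And>b. b < 0 \<Longrightarrow> cauchy_product R f u b = \<zero>"
      using left_finite_normalise[OF f] by blast
    have carr: "f \<in> carrier ?A" "u \<in> carrier ?A"
      using f u by (simp_all add: artinian_algebra_simps)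
    define p where "p = f \<otimes>\<^bsub>?A\<^esub> u"
    define n where "n = \<one>\<^bsub>?A\<^esub> \<ominus>\<^bsub>?A\<^esub> p"
    have p: "p \<in> carrier ?A" and n: "n \<in> carrier ?A"
      using carr by (simp_all add: p_def n_def)
    have pn: "p \<oplus>\<^bsub>?A\<^esub> n = \<one>\<^bsub>?A\<^esub>"
      using p by (simp add: n_def A.minus_eq A.a_lcomm[of p "\<one>\<^bsub>?A\<^esub>"] A.r_neg)
    have n_zero: "n b = \<zero>" if "b \<le> 0" for b
    proof -
      have nb: "n b \<in> carrier R"
        using n by (simp add: artinian_algebra_simps left_finite_coeff)
      have "p b \<oplus> n b = (if b = 0 then \<one> else \<zero>)"
        using fun_cong[OF pn, of b] by (simp add: artinian_algebra_simps)
      moreover have "p b = (if b = 0 then \<one> else \<zero>)"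
        using u(2) below that by (auto simp: p_def artinian_algebra_simps)
      ultimately show ?thesis
        using nb by (auto split: if_splits)
    qed
    have "\<exists>g\<in>carrier ?A. g = \<one>\<^bsub>?A\<^esub> \<oplus>\<^bsub>?A\<^esub> n \<otimes>\<^bsub>?A\<^esub> g"
    proof (cases "\<exists>b. n b \<noteq> \<zero>")
      case True
      then obtain \<epsilon> where \<epsilon>: "n \<epsilon> \<noteq> \<zero>" "\<And>b. b < \<epsilon> \<Longrightarrow> n b = \<zero>"
        using left_finite_least_exponent[of n R] n by (auto simp: artinian_algebra_simps)
      have "0 < \<epsilon>" using \<epsilon>(1) n_zero by (meson not_le)
      then show ?thesis
        using left_finite_fixed_point[of n \<epsilon>] \<epsilon>(2) n
        unfolding artinian_algebra_simps by metis
    next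
      \<comment> \<open>A separate case, because the trivial group has no positive \<open>\<epsilon>\<close>.\<close>
      case False
      then have "n = \<zero>\<^bsub>?A\<^esub>" by (auto simp: artinian_algebra_simps)
      then show ?thesis by (intro bexI[of _ "\<one>\<^bsub>?A\<^esub>"]) auto
    qed
    then obtain g where g: "g \<in> carrier ?A" "g = \<one>\<^bsub>?A\<^esub> \<oplus>\<^bsub>?A\<^esub> n \<otimes>\<^bsub>?A\<^esub> g" by blast
    \<comment> \<open>Since \<open>p + n = 1\<close>, cancelling \<open>n g\<close> in \<open>p g + n g = g = 1 + n g\<close> leaves \<open>p g = 1\<close>.\<close>
    have "p \<otimes>\<^bsub>?A\<^esub> g \<oplus>\<^bsub>?A\<^esub> n \<otimes>\<^bsub>?A\<^esub> g = g"
      using p n g(1) pn by (simp flip: A.l_distr)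
    also have "\<dots> = \<one>\<^bsub>?A\<^esub> \<oplus>\<^bsub>?A\<^esub> n \<otimes>\<^bsub>?A\<^esub> g" by (fact g(2))
    finally have "p \<otimes>\<^bsub>?A\<^esub> g = \<one>\<^bsub>?A\<^esub>"
      using p n g(1) by simp
    then have "f \<otimes>\<^bsub>?A\<^esub> (u \<otimes>\<^bsub>?A\<^esub> g) = \<one>\<^bsub>?A\<^esub>"
      using carr g(1) by (simp add: p_def A.m_assoc)
    then show "\<exists>b\<in>carrier ?A. f \<otimes>\<^bsub>?A\<^esub> b = \<one>\<^bsub>?A\<^esub>"
      using carr g(1) by blast
  qed
qed

end

section \<open>Reversal of exponents\<close>

lemma minus_diff_eq_iff:
  fixes x y z :: "'b::ab_group_add"
  shows "- x - y = z \<longleftrightarrow> x + y = - z"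
proof -
  have "- x - y = - (x + y)" by simp
  then show ?thesis by (metis minus_minus)
qed

lemma (in cring) cauchy_product_reverse:
  fixes c d :: "'r::archimedean_group \<Rightarrow> 'a"
  assumes c: "\<And>a. c a \<in> carrier R" and d: "\<And>a. d a \<in> carrier R"
  shows "cauchy_product R (\<lambda>a. c (- a)) (\<lambda>a. d (- a)) e = cauchy_product R c d (- e)"
proof -
  let ?P = "{(a, b). a + b = e \<and> c (- a) \<noteq> \<zero> \<and> d (- b) \<noteq> \<zero>}"
  have "{(a, b). a + b = - e \<and> c a \<noteq> \<zero> \<and> d b \<noteq> \<zero>} = map_prod uminus uminus ` ?P" (is "?Q = _")
  proof (intro equalityI subsetI)
    fix p assume "p \<in> ?Q"
    then have "(- fst p, - snd p) \<in> ?P"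
      by (auto simp: minus_diff_eq_iff add.commute)
    then show "p \<in> map_prod uminus uminus ` ?P"
      by (rule rev_image_eqI) simp
  next
    fix p assume "p \<in> map_prod uminus uminus ` ?P"
    then show "p \<in> ?Q"
      by (auto simp: minus_diff_eq_iff add.commute)
  qed
  then have "cauchy_product R c d (- e)
      = (\<Oplus>p\<in>map_prod uminus uminus ` ?P. c (fst p) \<otimes> d (snd p))"
    by (simp add: cauchy_product_def formal_sum_algebra_def)
  also have "\<dots> = (\<Oplus>p\<in>?P. c (- fst p) \<otimes> d (- snd p))"
    by (subst finsum_reindex) (auto simp: c d inj_on_def)
  also have "\<dots> = cauchy_product R (\<lambda>a. c (- a)) (\<lambda>a. d (- a)) e"
    by (simp add: cauchy_product_def formal_sum_algebra_def)
  finally show ?thesis ..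
qed

lemma finite_reverse_iff:
  fixes a :: "'r::archimedean_group"
  shows "finite {b. a \<le> b \<and> P (- b)} \<longleftrightarrow> finite {b. b \<le> - a \<and> P b}"
proof -
  have "{b. b \<le> - a \<and> P b} = uminus ` {b. a \<le> b \<and> P (- b)}"
  proof (intro equalityI subsetI)
    fix b assume "b \<in> {b. b \<le> - a \<and> P b}"
    then show "b \<in> uminus ` {b. a \<le> b \<and> P (- b)}"
      by (intro rev_image_eqI[of "- b"]) (simp_all add: le_minus_iff)
  qed auto
  then show ?thesis by (simp add: finite_image_iff)
qed

lemma left_finite_reverse_iff:
  "(\<lambda>a. c (- a)) \<in> left_finite K
    \<longleftrightarrow> (\<forall>a. c a \<in> carrier K) \<and> (\<forall>a. finite {b. a \<le> b \<and> c b \<noteq> \<zero>\<^bsub>K\<^esub>})"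
  using finite_reverse_iff[of _ "\<lambda>b. c (- b) \<noteq> \<zero>\<^bsub>K\<^esub>"]
  by (simp add: left_finite_def artinian_algebra_def formal_sum_algebra_def) (metis minus_minus)

lemma noetherian_algebra_simps:
  "carrier (noetherian_algebra K) = {c. (\<lambda>a. c (- a)) \<in> left_finite K}"
  "monoid.mult (noetherian_algebra K) = cauchy_product K"
  "one (noetherian_algebra K) = (\<lambda>a. if a = 0 then \<one>\<^bsub>K\<^esub> else \<zero>\<^bsub>K\<^esub>)"
  "zero (noetherian_algebra K) = (\<lambda>a. \<zero>\<^bsub>K\<^esub>)"
  "add (noetherian_algebra K) = (\<lambda>c d a. c a \<oplus>\<^bsub>K\<^esub> d a)"
  by (simp_all add: left_finite_reverse_iff cauchy_product_def noetherian_algebra_def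
      formal_sum_algebra_def)

lemma (in cring) reverse_ring_iso:
  "(\<lambda>c a. c (- a)) \<in> ring_iso (artinian_algebra R)
     (noetherian_algebra R :: ('a, 'r::archimedean_group \<Rightarrow> 'a) module)"
proof (rule ring_iso_memI, unfold artinian_algebra_simps noetherian_algebra_simps)
  fix c d :: "'r \<Rightarrow> 'a"
  assume "c \<in> left_finite R" "d \<in> left_finite R"
  then show "(\<lambda>a. cauchy_product R c d (- a))
    = cauchy_product R (\<lambda>a. c (- a)) (\<lambda>a. d (- a))"
    by (intro ext cauchy_product_reverse[symmetric] left_finite_coeff)
next
  show "bij_betw (\<lambda>(c :: 'r \<Rightarrow> 'a) a. c (- a)) (left_finite R)
    {c. (\<lambda>a. c (- a)) \<in> left_finite R}"
    by (rule bij_betw_byWitness[of _ "\<lambda>c a. c (- a)"]) auto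
qed auto

theorem proposition1p5:
  fixes K :: "('k, 'm) ring_scheme"
  assumes "field K"
  shows "field (artinian_algebra K :: ('k, 'r::archimedean_group \<Rightarrow> 'k) module) \<and>
         field (noetherian_algebra K :: ('k, 'r::archimedean_group \<Rightarrow> 'k) module)"
proof
  interpret field K by (fact assms)
  show artinian: "field (artinian_algebra K :: ('k, 'r \<Rightarrow> 'k) module)"
    by (rule artinian_algebra_field)
  show "field (noetherian_algebra K :: ('k, 'r \<Rightarrow> 'k) module)"
    using field.ring_iso_imp_img_field[OF artinian reverse_ring_iso]
    by (simp add: artinian_algebra_simps noetherian_algebra_def formal_sum_algebra_def)
qed

end
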